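(* Let $\ell$ be an admissible transversal of a triangle $ABC$, meeting the sidelines $BC,CA,AB$ at $D,E,F$. Suppose the triangle center $X$ is concurrent for $\ell$ and that the $X$-point of each of the corner triangles $AEF$, $BFD$, $CDE$ lies on no sideline of that corner triangle. Then the isogonal conjugate $X^{*}$ and the isotomic conjugate $X^{-1}$ of $X$ are also concurrent for $\ell$.
   Context: An admissible transversal of $\triangle ABC$ is a line that passes through no vertex and is parallel to no side. A (barycentric) center function is a function $f(x,y,z)$ of side lengths, homogeneous and symmetric in its last two arguments; for a triangle $P_1P_2P_3$ whose sides opposite $P_1,P_2,P_3$ have lengths $\lambda_1,\lambda_2,\lambda_3$, its $X$-point is the point with homogeneous barycentric coordinates $(f(\lambda_1,\lambda_2,\lambda_3):f(\lambda_2,\lambda_3,\lambda_1):f(\lambda_3,\lambda_1,\lambda_2))$ relative to $P_1P_2P_3$. With $G,H,I$ the $X$-points of triangles $AEF$, $BFD$, $CDE$, the center $X$ is called concurrent for $\ell$ if the lines $AG,BH,CI$ are concurrent (three parallel lines count as concurrent). If $X$ has center function $f(a,b,c)$, then $X^{-1}$ is the center with center function $1/f$ and $X^{*}$ is the center with center function $a^2/f$. *)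

theory Defs
  imports "HOL-Analysis.Analysis"
begin

definition triangle_sides :: "real \<Rightarrow> real \<Rightarrow> real \<Rightarrow> bool" where
  "triangle_sides x y z \<longleftrightarrow>
     x > 0 \<and> y > 0 \<and> z > 0 \<and> x < y + z \<and> y < z + x \<and> z < x + y"

text \<open>Center functions only matter on side lengths of triangles. The degree of homogeneity is
  an arbitrary real number.\<close>

definition center_function :: "(real \<Rightarrow> real \<Rightarrow> real \<Rightarrow> real) \<Rightarrow> bool" where
  "center_function f \<longleftrightarrow>
     (\<exists>n::real. \<forall>t x y z. t > 0 \<and> triangle_sides x y z \<longrightarrow>
        f (t * x) (t * y) (t * z) = t powr n * f x y z) \<and>
     (\<forall>x y z. triangle_sides x y z \<longrightarrow> f x y z = f x z y)"

text \<open>Where \<open>f\<close> vanishes, the value of either conjugate is the junk value \<open>0\<close>.\<close>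

definition isotomic_conjugate ::
    "(real \<Rightarrow> real \<Rightarrow> real \<Rightarrow> real) \<Rightarrow> real \<Rightarrow> real \<Rightarrow> real \<Rightarrow> real" where
  "isotomic_conjugate f = (\<lambda>x y z. 1 / f x y z)"

definition isogonal_conjugate ::
    "(real \<Rightarrow> real \<Rightarrow> real \<Rightarrow> real) \<Rightarrow> real \<Rightarrow> real \<Rightarrow> real \<Rightarrow> real" where
  "isogonal_conjugate f = (\<lambda>x y z. x\<^sup>2 / f x y z)"

lemma center_function_conjugates:
  assumes "center_function f"
  shows "center_function (isotomic_conjugate f)" "center_function (isogonal_conjugate f)"
proof -
  from assms obtain n where hom: "\<And>t x y z. t > 0 \<Longrightarrow> triangle_sides x y z \<Longrightarrow>
        f (t * x) (t * y) (t * z) = t powr n * f x y z"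
    and sym: "\<And>x y z. triangle_sides x y z \<Longrightarrow> f x y z = f x z y"
    unfolding center_function_def by blast
  have "isotomic_conjugate f (t * x) (t * y) (t * z) = t powr (- n) * isotomic_conjugate f x y z"
    if "t > 0" "triangle_sides x y z" for t x y z
    using hom[OF that] by (simp add: isotomic_conjugate_def powr_minus divide_simps)
  then show "center_function (isotomic_conjugate f)"
    using sym unfolding center_function_def isotomic_conjugate_def by metis
  have "isogonal_conjugate f (t * x) (t * y) (t * z) = t powr (2 - n) * isogonal_conjugate f x y z"
    if "t > 0" "triangle_sides x y z" for t x y z
    using hom[OF that] that(1) by (simp add: isogonal_conjugate_def powr_diff power_mult_distrib)
  then show "center_function (isogonal_conjugate f)"
    using sym unfolding center_function_def isogonal_conjugate_def by metis
qed

text \<open>Homogeneous barycentric coordinates may have sum zero, in which case they describe a point at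
  infinity. Points of the extended plane are therefore represented by nonzero vectors of
  \<open>(real^2) \<times> real\<close>, up to scaling: a point \<open>p\<close> of the plane is represented by \<open>(p, 1)\<close>, the point
  at infinity in direction \<open>v\<close> by \<open>(v, 0)\<close>. The zero vector, which arises from the coordinates
  \<open>(0 : 0 : 0)\<close>, represents no point.\<close>

definition hom_coords :: "real^2 \<Rightarrow> (real^2) \<times> real" where
  "hom_coords p = (p, 1)"

definition X_point ::
    "(real \<Rightarrow> real \<Rightarrow> real \<Rightarrow> real) \<Rightarrow> real^2 \<Rightarrow> real^2 \<Rightarrow> real^2 \<Rightarrow> (real^2) \<times> real" where
  "X_point f P1 P2 P3 =
     (let l1 = dist P2 P3; l2 = dist P3 P1; l3 = dist P1 P2
      in f l1 l2 l3 *\<^sub>R hom_coords P1 + f l2 l3 l1 *\<^sub>R hom_coords P2 + f l3 l1 l2 *\<^sub>R hom_coords P3)"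

text \<open>In the extended plane, the line joining the points represented by \<open>g\<close> and \<open>h\<close> consists of the
  points represented by the nonzero vectors of \<open>span {g, h}\<close>. The following is the ordinary part
  of the line joining a point \<open>P\<close> of the plane to the point represented by \<open>g\<close>; it is a line
  provided that \<open>g\<close> represents a point other than \<open>P\<close>, that is, \<open>g \<notin> span {hom_coords P}\<close>.\<close>

definition join_line :: "real^2 \<Rightarrow> (real^2) \<times> real \<Rightarrow> (real^2) set" where
  "join_line P g = {Q. hom_coords Q \<in> span {hom_coords P, g}}"

lemma mem_join_line_iff: "Q \<in> join_line P g \<longleftrightarrow> (\<exists>u v. hom_coords Q = u *\<^sub>R hom_coords P + v *\<^sub>R g)"
proof
  assume "Q \<in> join_line P g"
  then obtain u v where "hom_coords Q - u *\<^sub>R hom_coords P = v *\<^sub>R g"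
    by (auto simp: join_line_def span_breakdown_eq)
  then have "hom_coords Q = u *\<^sub>R hom_coords P + v *\<^sub>R g"
    by (metis add.commute diff_add_cancel)
  then show "\<exists>u v. hom_coords Q = u *\<^sub>R hom_coords P + v *\<^sub>R g" by blast
next
  assume "\<exists>u v. hom_coords Q = u *\<^sub>R hom_coords P + v *\<^sub>R g"
  then show "Q \<in> join_line P g"
    unfolding join_line_def mem_Collect_eq
    by (metis insertCI span_add span_base span_scale)
qed

lemma join_line_hom_coords: "join_line P (hom_coords Q) = affine hull {P, Q}"
  unfolding set_eq_iff mem_join_line_iff affine_hull_2 by (auto simp: hom_coords_def)

lemma join_line_at_infinity: "join_line P (v, 0) = {P + t *\<^sub>R v |t. True}"
  unfolding set_eq_iff mem_join_line_iff by (auto simp: hom_coords_def)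

definition on_no_sideline ::
    "(real^2) \<times> real \<Rightarrow> real^2 \<Rightarrow> real^2 \<Rightarrow> real^2 \<Rightarrow> bool" where
  "on_no_sideline g P1 P2 P3 \<longleftrightarrow>
     g \<notin> span {hom_coords P2, hom_coords P3} \<and>
     g \<notin> span {hom_coords P3, hom_coords P1} \<and>
     g \<notin> span {hom_coords P1, hom_coords P2}"

definition concurrent_lines :: "(real^2) set \<Rightarrow> (real^2) set \<Rightarrow> (real^2) set \<Rightarrow> bool" where
  "concurrent_lines L M N \<longleftrightarrow>
     L \<inter> M \<inter> N \<noteq> {} \<or> (affine_parallel L M \<and> affine_parallel M N)"

definition admissible_transversal ::
    "real^2 \<Rightarrow> real^2 \<Rightarrow> real^2 \<Rightarrow> (real^2) set \<Rightarrow> bool" where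
  "admissible_transversal A B C l \<longleftrightarrow>
     affine l \<and> aff_dim l = 1 \<and> A \<notin> l \<and> B \<notin> l \<and> C \<notin> l \<and>
     \<not> affine_parallel l (affine hull {B, C}) \<and>
     \<not> affine_parallel l (affine hull {C, A}) \<and>
     \<not> affine_parallel l (affine hull {A, B})"

definition meets_sidelines_at ::
    "real^2 \<Rightarrow> real^2 \<Rightarrow> real^2 \<Rightarrow> (real^2) set \<Rightarrow> real^2 \<Rightarrow> real^2 \<Rightarrow> real^2 \<Rightarrow> bool" where
  "meets_sidelines_at A B C l D E F \<longleftrightarrow>
     l \<inter> affine hull {B, C} = {D} \<and> l \<inter> affine hull {C, A} = {E} \<and> l \<inter> affine hull {A, B} = {F}"

text \<open>The points \<open>D\<close>, \<open>E\<close>, \<open>F\<close> are determined by \<open>l\<close>. The three conditions \<open>\<dots> \<notin> span \<dots>\<close> say that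
  the lines \<open>AG\<close>, \<open>BH\<close>, \<open>CI\<close> are defined.\<close>

definition concurrent_for ::
    "(real \<Rightarrow> real \<Rightarrow> real \<Rightarrow> real) \<Rightarrow> real^2 \<Rightarrow> real^2 \<Rightarrow> real^2 \<Rightarrow> (real^2) set \<Rightarrow> bool" where
  "concurrent_for f A B C l \<longleftrightarrow>
     (\<exists>D E F. meets_sidelines_at A B C l D E F \<and>
        (let G = X_point f A E F; H = X_point f B F D; I = X_point f C D E
         in G \<notin> span {hom_coords A} \<and> H \<notin> span {hom_coords B} \<and> I \<notin> span {hom_coords C} \<and>
            concurrent_lines (join_line A G) (join_line B H) (join_line C I)))"

end

theory Submission
  imports Defs
begin

text \<open>
  The conjugates are handled by one criterion, which describes concurrency by a product.

  Three lines \<open>AG\<close>, \<open>BH\<close>, \<open>CI\<close> of the extended plane are concurrent, parallel lines included, iff the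
  three planes representing them in \<open>(real^2) \<times> real\<close> share a nonzero vector
  (\<open>concurrent_join_lines_iff\<close>). In barycentric coordinates relative to \<open>ABC\<close> this is Ceva's
  theorem (\<open>ceva\<close>). Write \<open>F = (1 - r) A + r B\<close>, \<open>E = (1 - e) A + e C\<close>, \<open>D = (1 - d) B + d C\<close>.
  If the \<open>X\<close>-point of \<open>AEF\<close> has coordinates \<open>(f\<^sub>1 : f\<^sub>2 : f\<^sub>3)\<close> relative to \<open>AEF\<close>, then the line
  \<open>AG\<close> has the equation \<open>y : z = f\<^sub>3 r : f\<^sub>2 e\<close>, and similarly at the other two corners. The product
  of the factors that depend on \<open>d, e, r\<close> only is \<open>-1\<close> by the theorem of Menelaus, so that
  \<open>X\<close> is concurrent iff \<open>f\<^sub>3 g\<^sub>3 h\<^sub>3 = - f\<^sub>2 g\<^sub>2 h\<^sub>2\<close>, where \<open>g\<close> and \<open>h\<close> are the coordinates at the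
  other corners (\<open>concurrent_for_iff\<close>). None of these coordinates vanishes, because \<open>G\<close>, \<open>H\<close>, \<open>I\<close>
  lie on no sideline of their corner triangles.

  This condition is invariant under inverting all the coordinates, which gives \<open>X\<^sup>-\<^sup>1\<close>. For \<open>X\<^sup>*\<close>
  the two sides acquire the factors \<open>(AE \<cdot> BF \<cdot> CD)\<^sup>2\<close> and \<open>(FA \<cdot> DB \<cdot> EC)\<^sup>2\<close>, which are equal, once
  more by Menelaus.
\<close>

section \<open>Concurrency in homogeneous coordinates\<close>

lemma mem_span_pair_iff: "w \<in> span {a, b} \<longleftrightarrow> (\<exists>u v. w = u *\<^sub>R a + v *\<^sub>R b)"
proof -
  have "w \<in> span {a, b} \<longleftrightarrow> (\<exists>u v. w - u *\<^sub>R a = v *\<^sub>R b)"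
    by (auto simp: span_breakdown_eq)
  also have "\<dots> \<longleftrightarrow> (\<exists>u v. w = u *\<^sub>R a + v *\<^sub>R b)"
    by (metis add.commute diff_add_cancel add_diff_cancel_left')
  finally show ?thesis .
qed

lemma join_line_contains_point: "P \<in> join_line P g"
  by (simp add: join_line_def span_base)

lemma join_line_second_point:
  assumes "g \<notin> span {hom_coords P}"
  obtains v where "v \<noteq> 0" "P + v \<in> join_line P g"
proof (cases "snd g = 0")
  case True
  then have g: "g = (fst g, 0)" by (simp add: prod_eq_iff)
  have "fst g \<noteq> 0" using assms g by (metis span_zero zero_prod_def)
  moreover have "P + fst g \<in> join_line P g"
    by (subst g) (metis (mono_tags, lifting) join_line_at_infinity mem_Collect_eq scaleR_one)
  ultimately show ?thesis using that by blast
next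
  case False
  define R where "R = (1 / snd g) *\<^sub>R fst g"
  have R: "hom_coords R = (1 / snd g) *\<^sub>R g"
    using False by (simp add: R_def hom_coords_def prod_eq_iff)
  then have g: "g = snd g *\<^sub>R hom_coords R" using False by simp
  have "R \<noteq> P" using assms g by (metis span_base span_scale insertI1)
  moreover have "R \<in> join_line P g"
    unfolding join_line_def mem_Collect_eq R by (intro span_scale span_base) simp
  ultimately show ?thesis using that[of "R - P"] by simp
qed

text \<open>A point at infinity on a line gives the direction of the line.\<close>

lemma join_line_direction:
  assumes "g \<notin> span {hom_coords P}" "v \<noteq> 0" "(v, 0) \<in> span {hom_coords P, g}"
  shows "join_line P g = {P + t *\<^sub>R v |t. True}"
proof -
  obtain a b where ab: "(v, 0) = a *\<^sub>R hom_coords P + b *\<^sub>R g"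
    using assms(3) by (auto simp: mem_span_pair_iff)
  have "b \<noteq> 0"
  proof
    assume "b = 0"
    then have "a = 0" "v = a *\<^sub>R P" using ab by (auto simp: hom_coords_def)
    then show False using assms(2) by simp
  qed
  then have "g = (- a / b) *\<^sub>R hom_coords P + (1 / b) *\<^sub>R (v, 0)"
    unfolding ab by (simp add: scaleR_add_right)
  then have "g \<in> span {hom_coords P, (v, 0)}" unfolding mem_span_pair_iff by blast
  then have "span {hom_coords P, g} = span {hom_coords P, (v, 0)}"
    using assms(3) by (intro span_eq[THEN iffD2]) (simp add: span_base)
  then have "join_line P g = join_line P (v, 0)" by (simp add: join_line_def)
  then show ?thesis by (simp add: join_line_at_infinity)
qed

lemma direction_of_two_points:
  assumes "Q \<in> join_line P g" "Q + v \<in> join_line P g"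
  shows "(v, 0) \<in> span {hom_coords P, g}"
proof -
  have "(v, 0) = hom_coords (Q + v) - hom_coords Q" by (simp add: hom_coords_def)
  then show ?thesis using assms unfolding join_line_def by (metis mem_Collect_eq span_diff)
qed

lemma affine_parallel_translates: "affine_parallel {P + t *\<^sub>R v |t. True} {Q + t *\<^sub>R v |t. True}"
  unfolding affine_parallel_def
proof
  show "{Q + t *\<^sub>R v |t. True} = (+) (Q - P) ` {P + t *\<^sub>R v |t. True}"
    by (force simp: image_iff)
qed

text \<open>A common vector \<open>w\<close> represents a common point if \<open>snd w \<noteq> 0\<close>, and a common direction of the
  three lines otherwise.\<close>

lemma concurrent_join_lines_iff:
  assumes g: "g \<notin> span {hom_coords P}" and h: "h \<notin> span {hom_coords Q}"
    and k: "k \<notin> span {hom_coords R}"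
  shows "concurrent_lines (join_line P g) (join_line Q h) (join_line R k) \<longleftrightarrow>
    (\<exists>w. w \<noteq> 0 \<and> w \<in> span {hom_coords P, g} \<and> w \<in> span {hom_coords Q, h} \<and>
         w \<in> span {hom_coords R, k})" (is "?conc \<longleftrightarrow> (\<exists>w. ?common w)")
proof
  assume ?conc
  then consider S where "S \<in> join_line P g" "S \<in> join_line Q h" "S \<in> join_line R k"
    | "affine_parallel (join_line P g) (join_line Q h)"
      "affine_parallel (join_line Q h) (join_line R k)"
    unfolding concurrent_lines_def by blast
  then show "\<exists>w. ?common w"
  proof cases
    case 1
    then have "?common (hom_coords S)"
      by (auto simp: join_line_def) (simp add: hom_coords_def zero_prod_def)
    then show ?thesis by blast
  next
    case 2
    obtain v where v: "v \<noteq> 0" "P + v \<in> join_line P g" using join_line_second_point[OF g] .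
    obtain s t where s: "join_line Q h = (+) s ` join_line P g"
      and t: "join_line R k = (+) t ` join_line Q h"
      using 2 unfolding affine_parallel_def by blast
    have "s + P \<in> join_line Q h" "(s + P) + v \<in> join_line Q h"
      using v join_line_contains_point[of P g] unfolding s by (auto simp: add.assoc)
    moreover from this have "t + (s + P) \<in> join_line R k" "(t + (s + P)) + v \<in> join_line R k"
      unfolding t by (auto simp: add.assoc)
    ultimately have "?common (v, 0)"
      using v join_line_contains_point[of P g] direction_of_two_points
      by (auto simp: zero_prod_def)
    then show ?thesis by blast
  qed
next
  assume "\<exists>w. ?common w"
  then obtain w where w: "?common w" by blast
  show ?conc
  proof (cases "snd w = 0")
    case True
    define v where "v = fst w"
    have wv: "w = (v, 0)" using True by (simp add: v_def prod_eq_iff)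
    then have "v \<noteq> 0" using w by (auto simp: zero_prod_def)
    then have "join_line P g = {P + t *\<^sub>R v |t. True}" "join_line Q h = {Q + t *\<^sub>R v |t. True}"
      "join_line R k = {R + t *\<^sub>R v |t. True}"
      using w g h k wv join_line_direction by blast+
    then show ?thesis unfolding concurrent_lines_def by (metis affine_parallel_translates)
  next
    case False
    define S where "S = (1 / snd w) *\<^sub>R fst w"
    have "hom_coords S = (1 / snd w) *\<^sub>R w"
      using False by (simp add: S_def hom_coords_def prod_eq_iff)
    then have "S \<in> join_line P g \<inter> join_line Q h \<inter> join_line R k"
      using w by (simp add: join_line_def span_scale)
    then show ?thesis unfolding concurrent_lines_def by blast
  qed
qed

section \<open>The theorem of Ceva in barycentric coordinates\<close>

lemma barycentric_unique:
  assumes "\<not> collinear {A, B, C}"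
  shows "x *\<^sub>R hom_coords A + y *\<^sub>R hom_coords B + z *\<^sub>R hom_coords C =
         x' *\<^sub>R hom_coords A + y' *\<^sub>R hom_coords B + z' *\<^sub>R hom_coords C \<longleftrightarrow>
         x = x' \<and> y = y' \<and> z = z'" (is "?eq \<longleftrightarrow> _")
proof
  assume ?eq
  define p q r where "p = x - x'" and "q = y - y'" and "r = z - z'"
  have "p *\<^sub>R A + q *\<^sub>R B + r *\<^sub>R C = 0" and sum: "p + q + r = 0"
    using \<open>?eq\<close> by (auto simp: hom_coords_def p_def q_def r_def algebra_simps)
  moreover have p: "p = - q - r" using sum by simp
  ultimately have eq: "q *\<^sub>R (B - A) + r *\<^sub>R (C - A) = 0"
    by (simp add: algebra_simps)
  have nc: "\<not> collinear {0, B - A, C - A}"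
    using assms collinear_3[of B A C] by (simp add: insert_commute)
  have "r = 0"
  proof (rule ccontr)
    assume "r \<noteq> 0"
    have "r *\<^sub>R (C - A) = (- q) *\<^sub>R (B - A)" using eq by (simp add: add_eq_0_iff)
    then have "C - A = (- q / r) *\<^sub>R (B - A)"
      using \<open>r \<noteq> 0\<close> by (metis divide_inverse_commute scaleR_scaleR left_inverse scaleR_one)
    then show False using nc unfolding collinear_lemma by blast
  qed
  moreover from this have "q = 0" using eq nc unfolding collinear_lemma by simp
  ultimately show "x = x' \<and> y = y' \<and> z = z'" using sum by (simp add: p_def q_def r_def)
qed simp

text \<open>The line joining the first of three independent vectors to \<open>(m : p : q)\<close>.\<close>

lemma mem_span_vertex_iff:
  fixes a b c :: "'v::real_vector"
  assumes indep: "\<And>x y z x' y' z'. x *\<^sub>R a + y *\<^sub>R b + z *\<^sub>R c = x' *\<^sub>R a + y' *\<^sub>R b + z' *\<^sub>R c \<longleftrightarrow>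
      x = x' \<and> y = y' \<and> z = z'"
    and p: "p \<noteq> 0"
  shows "x *\<^sub>R a + y *\<^sub>R b + z *\<^sub>R c \<in> span {a, m *\<^sub>R a + p *\<^sub>R b + q *\<^sub>R c} \<longleftrightarrow> y * q = z * p"
proof -
  have comb: "u *\<^sub>R a + v *\<^sub>R (m *\<^sub>R a + p *\<^sub>R b + q *\<^sub>R c) =
      (u + v * m) *\<^sub>R a + (v * p) *\<^sub>R b + (v * q) *\<^sub>R c" for u v
    by (simp add: algebra_simps)
  have "x *\<^sub>R a + y *\<^sub>R b + z *\<^sub>R c \<in> span {a, m *\<^sub>R a + p *\<^sub>R b + q *\<^sub>R c} \<longleftrightarrow>
      (\<exists>u v. x = u + v * m \<and> y = v * p \<and> z = v * q)"
    unfolding mem_span_pair_iff comb indep ..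
  also have "\<dots> \<longleftrightarrow> y * q = z * p"
  proof
    assume "y * q = z * p"
    then have "x = (x - y / p * m) + y / p * m \<and> y = y / p * p \<and> z = y / p * q"
      using p by (simp add: field_simps)
    then show "\<exists>u v. x = u + v * m \<and> y = v * p \<and> z = v * q" by blast
  qed auto
  finally show ?thesis .
qed

lemma ratio_system_solvable_iff:
  fixes p\<^sub>1 :: "'k::field"
  assumes "p\<^sub>1 \<noteq> 0" "p\<^sub>2 \<noteq> 0" "p\<^sub>3 \<noteq> 0" "q\<^sub>1 \<noteq> 0" "q\<^sub>2 \<noteq> 0" "q\<^sub>3 \<noteq> 0"
  shows "(\<exists>x y z. (x \<noteq> 0 \<or> y \<noteq> 0 \<or> z \<noteq> 0) \<and> y * q\<^sub>1 = z * p\<^sub>1 \<and> z * q\<^sub>2 = x * p\<^sub>2 \<and> x * q\<^sub>3 = y * p\<^sub>3) \<longleftrightarrow>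
         p\<^sub>1 * p\<^sub>2 * p\<^sub>3 = q\<^sub>1 * q\<^sub>2 * q\<^sub>3"
proof
  assume "\<exists>x y z. (x \<noteq> 0 \<or> y \<noteq> 0 \<or> z \<noteq> 0) \<and> y * q\<^sub>1 = z * p\<^sub>1 \<and> z * q\<^sub>2 = x * p\<^sub>2 \<and> x * q\<^sub>3 = y * p\<^sub>3"
  then obtain x y z where nz: "x \<noteq> 0 \<or> y \<noteq> 0 \<or> z \<noteq> 0"
    and eqs: "y * q\<^sub>1 = z * p\<^sub>1" "z * q\<^sub>2 = x * p\<^sub>2" "x * q\<^sub>3 = y * p\<^sub>3" by blast
  have "x \<noteq> 0 \<and> y \<noteq> 0 \<and> z \<noteq> 0" using nz eqs assms by (metis mult_eq_0_iff)
  moreover have "(x * y * z) * (p\<^sub>1 * p\<^sub>2 * p\<^sub>3) = (z * p\<^sub>1) * (x * p\<^sub>2) * (y * p\<^sub>3)" by algebra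
  moreover have "\<dots> = (x * y * z) * (q\<^sub>1 * q\<^sub>2 * q\<^sub>3)" unfolding eqs[symmetric] by algebra
  ultimately show "p\<^sub>1 * p\<^sub>2 * p\<^sub>3 = q\<^sub>1 * q\<^sub>2 * q\<^sub>3" by simp
next
  assume "p\<^sub>1 * p\<^sub>2 * p\<^sub>3 = q\<^sub>1 * q\<^sub>2 * q\<^sub>3"
  then have "p\<^sub>1 * q\<^sub>1 = q\<^sub>1 * p\<^sub>1 \<and> q\<^sub>1 * q\<^sub>2 = (q\<^sub>1 * q\<^sub>2 / p\<^sub>2) * p\<^sub>2 \<and> (q\<^sub>1 * q\<^sub>2 / p\<^sub>2) * q\<^sub>3 = p\<^sub>1 * p\<^sub>3"
    using assms by (simp add: field_simps)
  then show "\<exists>x y z. (x \<noteq> 0 \<or> y \<noteq> 0 \<or> z \<noteq> 0) \<and> y * q\<^sub>1 = z * p\<^sub>1 \<and> z * q\<^sub>2 = x * p\<^sub>2 \<and> x * q\<^sub>3 = y * p\<^sub>3"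
    using assms by blast
qed

lemma vertex_line_defined:
  assumes "\<not> collinear {A, B, C}" "p \<noteq> 0"
  shows "m *\<^sub>R hom_coords A + p *\<^sub>R hom_coords B + q *\<^sub>R hom_coords C \<notin> span {hom_coords A}"
proof
  assume "m *\<^sub>R hom_coords A + p *\<^sub>R hom_coords B + q *\<^sub>R hom_coords C \<in> span {hom_coords A}"
  then obtain u where "m *\<^sub>R hom_coords A + p *\<^sub>R hom_coords B + q *\<^sub>R hom_coords C =
      u *\<^sub>R hom_coords A + 0 *\<^sub>R hom_coords B + 0 *\<^sub>R hom_coords C"
    by (auto simp: span_singleton)
  then show False using assms(2) unfolding barycentric_unique[OF assms(1)] by simp
qed

lemma ceva:
  assumes nc: "\<not> collinear {A, B, C}"
    and nz: "p\<^sub>1 \<noteq> 0" "p\<^sub>2 \<noteq> 0" "p\<^sub>3 \<noteq> 0" "q\<^sub>1 \<noteq> 0" "q\<^sub>2 \<noteq> 0" "q\<^sub>3 \<noteq> 0"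
    and G: "G = m\<^sub>1 *\<^sub>R hom_coords A + p\<^sub>1 *\<^sub>R hom_coords B + q\<^sub>1 *\<^sub>R hom_coords C"
    and H: "H = m\<^sub>2 *\<^sub>R hom_coords B + p\<^sub>2 *\<^sub>R hom_coords C + q\<^sub>2 *\<^sub>R hom_coords A"
    and I: "I = m\<^sub>3 *\<^sub>R hom_coords C + p\<^sub>3 *\<^sub>R hom_coords A + q\<^sub>3 *\<^sub>R hom_coords B"
  shows "G \<notin> span {hom_coords A}" "H \<notin> span {hom_coords B}" "I \<notin> span {hom_coords C}"
    and "concurrent_lines (join_line A G) (join_line B H) (join_line C I) \<longleftrightarrow>
         p\<^sub>1 * p\<^sub>2 * p\<^sub>3 = q\<^sub>1 * q\<^sub>2 * q\<^sub>3"
proof -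
  have ncB: "\<not> collinear {B, C, A}" and ncC: "\<not> collinear {C, A, B}"
    using nc by (simp_all add: insert_commute)
  show GA: "G \<notin> span {hom_coords A}" unfolding G using nc nz by (intro vertex_line_defined)
  show HB: "H \<notin> span {hom_coords B}" unfolding H using ncB nz by (intro vertex_line_defined)
  show IC: "I \<notin> span {hom_coords C}" unfolding I using ncC nz by (intro vertex_line_defined)
  let ?w = "\<lambda>x y z. x *\<^sub>R hom_coords A + y *\<^sub>R hom_coords B + z *\<^sub>R hom_coords C"
  have wG: "?w x y z \<in> span {hom_coords A, G} \<longleftrightarrow> y * q\<^sub>1 = z * p\<^sub>1" for x y z
    unfolding G using barycentric_unique[OF nc] nz(1) by (rule mem_span_vertex_iff)
  have wB: "?w x y z = y *\<^sub>R hom_coords B + z *\<^sub>R hom_coords C + x *\<^sub>R hom_coords A" for x y z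
    by (simp add: add_ac)
  have wH: "?w x y z \<in> span {hom_coords B, H} \<longleftrightarrow> z * q\<^sub>2 = x * p\<^sub>2" for x y z
    unfolding H wB using barycentric_unique[OF ncB] nz(2) by (rule mem_span_vertex_iff)
  have wC: "?w x y z = z *\<^sub>R hom_coords C + x *\<^sub>R hom_coords A + y *\<^sub>R hom_coords B" for x y z
    by (simp add: add_ac)
  have wI: "?w x y z \<in> span {hom_coords C, I} \<longleftrightarrow> x * q\<^sub>3 = y * p\<^sub>3" for x y z
    unfolding I wC using barycentric_unique[OF ncC] nz(3) by (rule mem_span_vertex_iff)
  have w0: "?w x y z = 0 \<longleftrightarrow> x = 0 \<and> y = 0 \<and> z = 0" for x y z
    using barycentric_unique[OF nc, of x y z 0 0 0] by simp
  have ex: "\<exists>x y z. w = ?w x y z" if "w \<in> span {hom_coords A, G}" for w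
  proof -
    obtain u v where "w = u *\<^sub>R hom_coords A + v *\<^sub>R G"
      using \<open>w \<in> _\<close> by (auto simp: mem_span_pair_iff)
    then have "w = ?w (u + v * m\<^sub>1) (v * p\<^sub>1) (v * q\<^sub>1)" by (simp add: G algebra_simps)
    then show ?thesis by blast
  qed
  have "concurrent_lines (join_line A G) (join_line B H) (join_line C I) \<longleftrightarrow>
    (\<exists>w. w \<noteq> 0 \<and> w \<in> span {hom_coords A, G} \<and> w \<in> span {hom_coords B, H} \<and>
         w \<in> span {hom_coords C, I})"
    using GA HB IC by (rule concurrent_join_lines_iff)
  also have "\<dots> \<longleftrightarrow> (\<exists>x y z. ?w x y z \<noteq> 0 \<and> ?w x y z \<in> span {hom_coords A, G} \<and>
      ?w x y z \<in> span {hom_coords B, H} \<and> ?w x y z \<in> span {hom_coords C, I})"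
    using ex by metis
  also have "\<dots> \<longleftrightarrow> (\<exists>x y z. (x \<noteq> 0 \<or> y \<noteq> 0 \<or> z \<noteq> 0) \<and>
      y * q\<^sub>1 = z * p\<^sub>1 \<and> z * q\<^sub>2 = x * p\<^sub>2 \<and> x * q\<^sub>3 = y * p\<^sub>3)"
    unfolding wG wH wI w0 by blast
  also have "\<dots> \<longleftrightarrow> p\<^sub>1 * p\<^sub>2 * p\<^sub>3 = q\<^sub>1 * q\<^sub>2 * q\<^sub>3"
    using nz by (rule ratio_system_solvable_iff)
  finally show "concurrent_lines (join_line A G) (join_line B H) (join_line C I) \<longleftrightarrow>
      p\<^sub>1 * p\<^sub>2 * p\<^sub>3 = q\<^sub>1 * q\<^sub>2 * q\<^sub>3" .
qed

section \<open>The theorem of Menelaus\<close>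

lemma affine_hull_pair_param:
  assumes "P \<in> affine hull {A, B}"
  obtains r where "P = (1 - r) *\<^sub>R A + r *\<^sub>R B"
  using assms by (auto simp: affine_hull_2) (metis add_diff_cancel_right')

lemma menelaus:
  fixes A B C :: "real^2"
  assumes l: "affine l" "aff_dim l = 1" "A \<notin> l" "B \<notin> l" "C \<notin> l"
    and meets: "meets_sidelines_at A B C l D E F"
  obtains d e r where "D = (1 - d) *\<^sub>R B + d *\<^sub>R C" "E = (1 - e) *\<^sub>R A + e *\<^sub>R C"
    "F = (1 - r) *\<^sub>R A + r *\<^sub>R B"
    "d \<noteq> 0" "d \<noteq> 1" "e \<noteq> 0" "e \<noteq> 1" "r \<noteq> 0" "r \<noteq> 1"
    "r * d * (1 - e) = - (e * (1 - r) * (1 - d))"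
proof -
  have DEF: "D \<in> l" "E \<in> l" "F \<in> l"
    "D \<in> affine hull {B, C}" "E \<in> affine hull {A, C}" "F \<in> affine hull {A, B}"
    using meets unfolding meets_sidelines_at_def by (auto simp: insert_commute)
  obtain d where d: "D = (1 - d) *\<^sub>R B + d *\<^sub>R C" using DEF(4) by (rule affine_hull_pair_param)
  obtain e where e: "E = (1 - e) *\<^sub>R A + e *\<^sub>R C" using DEF(5) by (rule affine_hull_pair_param)
  obtain r where r: "F = (1 - r) *\<^sub>R A + r *\<^sub>R B" using DEF(6) by (rule affine_hull_pair_param)
  have ne: "d \<noteq> 0" "d \<noteq> 1" "e \<noteq> 0" "e \<noteq> 1" "r \<noteq> 0" "r \<noteq> 1"
    using l DEF d e r by auto
  \<comment> \<open>The values at \<open>A\<close>, \<open>B\<close>, \<open>C\<close> of an affine function vanishing exactly on \<open>l\<close> express all the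
    ratios.\<close>
  obtain n k where nk: "l = {x. n \<bullet> x = k}"
    using l aff_dim_eq_hyperplane[of l] by (auto simp: affine_hull_eq[THEN iffD2])
  define \<alpha> \<beta> \<gamma> where "\<alpha> = n \<bullet> A - k" and "\<beta> = n \<bullet> B - k" and "\<gamma> = n \<bullet> C - k"
  have nz: "\<alpha> \<noteq> 0" "\<beta> \<noteq> 0" "\<gamma> \<noteq> 0" using l nk by (auto simp: \<alpha>_def \<beta>_def \<gamma>_def)
  have "(1 - d) * \<beta> + d * \<gamma> = n \<bullet> D - k" "(1 - e) * \<alpha> + e * \<gamma> = n \<bullet> E - k"
    "(1 - r) * \<alpha> + r * \<beta> = n \<bullet> F - k"
    unfolding d e r \<alpha>_def \<beta>_def \<gamma>_def by (simp_all add: inner_add_right algebra_simps)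
  then have ratios: "(1 - d) * \<beta> = - (d * \<gamma>)" "(1 - e) * \<alpha> = - (e * \<gamma>)" "(1 - r) * \<alpha> = - (r * \<beta>)"
    using DEF nk by auto
  have "(r * d * (1 - e)) * (\<alpha> * \<beta> * \<gamma>) = (r * \<beta>) * (d * \<gamma>) * ((1 - e) * \<alpha>)" by algebra
  also have "\<dots> = (- ((1 - r) * \<alpha>)) * (- ((1 - d) * \<beta>)) * (- (e * \<gamma>))"
    using ratios by simp
  also have "\<dots> = (- (e * (1 - r) * (1 - d))) * (\<alpha> * \<beta> * \<gamma>)" by algebra
  finally have "r * d * (1 - e) = - (e * (1 - r) * (1 - d))"
    using nz by (subst (asm) mult_right_cancel) auto
  then show thesis using that d e r ne by blast
qed

lemma menelaus_dist:
  fixes A B C D E F :: "real^2"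
  assumes "D = (1 - d) *\<^sub>R B + d *\<^sub>R C" "E = (1 - e) *\<^sub>R A + e *\<^sub>R C" "F = (1 - r) *\<^sub>R A + r *\<^sub>R B"
    and men: "r * d * (1 - e) = - (e * (1 - r) * (1 - d))"
  shows "dist A E * dist B F * dist C D = dist F A * dist D B * dist E C"
proof -
  have "A - E = e *\<^sub>R (A - C)" "B - F = (1 - r) *\<^sub>R (B - A)" "C - D = (1 - d) *\<^sub>R (C - B)"
    "F - A = r *\<^sub>R (B - A)" "D - B = d *\<^sub>R (C - B)" "E - C = (1 - e) *\<^sub>R (A - C)"
    unfolding assms(1-3) by (simp_all add: algebra_simps)
  then have dists: "dist A E = \<bar>e\<bar> * dist A C" "dist B F = \<bar>1 - r\<bar> * dist B A"
    "dist C D = \<bar>1 - d\<bar> * dist C B" "dist F A = \<bar>r\<bar> * dist B A" "dist D B = \<bar>d\<bar> * dist C B"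
    "dist E C = \<bar>1 - e\<bar> * dist A C"
    by (simp_all add: dist_norm)
  have "\<bar>r\<bar> * \<bar>d\<bar> * \<bar>1 - e\<bar> = \<bar>e\<bar> * \<bar>1 - r\<bar> * \<bar>1 - d\<bar>"
    using arg_cong[OF men, of abs] by (simp add: abs_mult)
  then show ?thesis unfolding dists by algebra
qed

section \<open>Concurrent centers\<close>

lemma meets_sidelines_at_unique:
  assumes "meets_sidelines_at A B C l D E F" "meets_sidelines_at A B C l D' E' F'"
  shows "D' = D" "E' = E" "F' = F"
  using assms unfolding meets_sidelines_at_def by auto

lemma X_point_eq:
  "X_point f P Q R = f (dist Q R) (dist R P) (dist P Q) *\<^sub>R hom_coords P
     + f (dist R P) (dist P Q) (dist Q R) *\<^sub>R hom_coords Q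
     + f (dist P Q) (dist Q R) (dist R P) *\<^sub>R hom_coords R"
  by (simp add: X_point_def Let_def)

lemma on_no_sideline_X_point:
  assumes "on_no_sideline (X_point f P Q R) P Q R"
  shows "f (dist R P) (dist P Q) (dist Q R) \<noteq> 0" "f (dist P Q) (dist Q R) (dist R P) \<noteq> 0"
proof -
  show "f (dist R P) (dist P Q) (dist Q R) \<noteq> 0"
  proof
    assume "f (dist R P) (dist P Q) (dist Q R) = 0"
    then have "X_point f P Q R = f (dist P Q) (dist Q R) (dist R P) *\<^sub>R hom_coords R
        + f (dist Q R) (dist R P) (dist P Q) *\<^sub>R hom_coords P" by (simp add: X_point_eq)
    then have "X_point f P Q R \<in> span {hom_coords R, hom_coords P}"
      unfolding mem_span_pair_iff by blast
    then show False using assms by (simp add: on_no_sideline_def)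
  qed
  show "f (dist P Q) (dist Q R) (dist R P) \<noteq> 0"
  proof
    assume "f (dist P Q) (dist Q R) (dist R P) = 0"
    then have "X_point f P Q R = f (dist Q R) (dist R P) (dist P Q) *\<^sub>R hom_coords P
        + f (dist R P) (dist P Q) (dist Q R) *\<^sub>R hom_coords Q" by (simp add: X_point_eq)
    then have "X_point f P Q R \<in> span {hom_coords P, hom_coords Q}"
      unfolding mem_span_pair_iff by blast
    then show False using assms by (simp add: on_no_sideline_def)
  qed
qed

lemma hom_coords_affine_comb:
  "hom_coords ((1 - t) *\<^sub>R P + t *\<^sub>R Q) = (1 - t) *\<^sub>R hom_coords P + t *\<^sub>R hom_coords Q"
  by (simp add: hom_coords_def)

text \<open>In each corner triangle, \<open>f\<close> is required not to vanish in the second and third coordinates only: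
  they determine the line through the first vertex, which is a vertex of \<open>ABC\<close>.\<close>

lemma concurrent_for_iff:
  fixes A B C D E F :: "real^2"
  assumes nc: "\<not> collinear {A, B, C}" and adm: "admissible_transversal A B C l"
    and meets: "meets_sidelines_at A B C l D E F"
    and f2: "f (dist F A) (dist A E) (dist E F) \<noteq> 0"
    and f3: "f (dist A E) (dist E F) (dist F A) \<noteq> 0"
    and g2: "f (dist D B) (dist B F) (dist F D) \<noteq> 0"
    and g3: "f (dist B F) (dist F D) (dist D B) \<noteq> 0"
    and h2: "f (dist E C) (dist C D) (dist D E) \<noteq> 0"
    and h3: "f (dist C D) (dist D E) (dist E C) \<noteq> 0"
  shows "concurrent_for f A B C l \<longleftrightarrow>
    f (dist A E) (dist E F) (dist F A) * f (dist B F) (dist F D) (dist D B) *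
      f (dist C D) (dist D E) (dist E C) =
    - (f (dist F A) (dist A E) (dist E F) * f (dist D B) (dist B F) (dist F D) *
      f (dist E C) (dist C D) (dist D E))"
proof -
  define f\<^sub>2 f\<^sub>3 g\<^sub>2 g\<^sub>3 h\<^sub>2 h\<^sub>3 where
    "f\<^sub>2 = f (dist F A) (dist A E) (dist E F)" and "f\<^sub>3 = f (dist A E) (dist E F) (dist F A)" and
    "g\<^sub>2 = f (dist D B) (dist B F) (dist F D)" and "g\<^sub>3 = f (dist B F) (dist F D) (dist D B)" and
    "h\<^sub>2 = f (dist E C) (dist C D) (dist D E)" and "h\<^sub>3 = f (dist C D) (dist D E) (dist E C)"
  note coord_defs = this
  obtain d e r where D: "D = (1 - d) *\<^sub>R B + d *\<^sub>R C" and E: "E = (1 - e) *\<^sub>R A + e *\<^sub>R C"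
    and F: "F = (1 - r) *\<^sub>R A + r *\<^sub>R B"
    and ne: "d \<noteq> 0" "d \<noteq> 1" "e \<noteq> 0" "e \<noteq> 1" "r \<noteq> 0" "r \<noteq> 1"
    and men: "r * d * (1 - e) = - (e * (1 - r) * (1 - d))"
    using adm meets menelaus[of l A B C D E F] unfolding admissible_transversal_def by metis
  note homs = hom_coords_affine_comb[of d B C, folded D] hom_coords_affine_comb[of e A C, folded E]
    hom_coords_affine_comb[of r A B, folded F]
  let ?G = "X_point f A E F" and ?H = "X_point f B F D" and ?I = "X_point f C D E"
  obtain m\<^sub>1 where G: "?G = m\<^sub>1 *\<^sub>R hom_coords A + (f\<^sub>3 * r) *\<^sub>R hom_coords B + (f\<^sub>2 * e) *\<^sub>R hom_coords C"
  proof
    show "?G = (f (dist E F) (dist F A) (dist A E) + f\<^sub>2 * (1 - e) + f\<^sub>3 * (1 - r)) *\<^sub>R hom_coords A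
        + (f\<^sub>3 * r) *\<^sub>R hom_coords B + (f\<^sub>2 * e) *\<^sub>R hom_coords C"
      unfolding X_point_eq coord_defs[symmetric] homs by (simp add: algebra_simps)
  qed
  obtain m\<^sub>2 where H: "?H = m\<^sub>2 *\<^sub>R hom_coords B + (g\<^sub>3 * d) *\<^sub>R hom_coords C + (g\<^sub>2 * (1 - r)) *\<^sub>R hom_coords A"
  proof
    show "?H = (f (dist F D) (dist D B) (dist B F) + g\<^sub>2 * r + g\<^sub>3 * (1 - d)) *\<^sub>R hom_coords B
        + (g\<^sub>3 * d) *\<^sub>R hom_coords C + (g\<^sub>2 * (1 - r)) *\<^sub>R hom_coords A"
      unfolding X_point_eq coord_defs[symmetric] homs by (simp add: algebra_simps)
  qed
  obtain m\<^sub>3 where I: "?I = m\<^sub>3 *\<^sub>R hom_coords C + (h\<^sub>3 * (1 - e)) *\<^sub>R hom_coords A + (h\<^sub>2 * (1 - d)) *\<^sub>R hom_coords B"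
  proof
    show "?I = (f (dist D E) (dist E C) (dist C D) + h\<^sub>2 * d + h\<^sub>3 * e) *\<^sub>R hom_coords C
        + (h\<^sub>3 * (1 - e)) *\<^sub>R hom_coords A + (h\<^sub>2 * (1 - d)) *\<^sub>R hom_coords B"
      unfolding X_point_eq coord_defs[symmetric] homs by (simp add: algebra_simps)
  qed
  have nz: "f\<^sub>3 * r \<noteq> 0" "g\<^sub>3 * d \<noteq> 0" "h\<^sub>3 * (1 - e) \<noteq> 0" "f\<^sub>2 * e \<noteq> 0" "g\<^sub>2 * (1 - r) \<noteq> 0" "h\<^sub>2 * (1 - d) \<noteq> 0"
    using ne f2 f3 g2 g3 h2 h3 by (simp_all add: coord_defs)
  note cev = ceva[OF nc nz G H I]
  have "concurrent_for f A B C l \<longleftrightarrow>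
      ?G \<notin> span {hom_coords A} \<and> ?H \<notin> span {hom_coords B} \<and> ?I \<notin> span {hom_coords C} \<and>
      concurrent_lines (join_line A ?G) (join_line B ?H) (join_line C ?I)"
    unfolding concurrent_for_def Let_def using meets meets_sidelines_at_unique[OF meets] by metis
  also have "\<dots> \<longleftrightarrow> f\<^sub>3 * r * (g\<^sub>3 * d) * (h\<^sub>3 * (1 - e)) = f\<^sub>2 * e * (g\<^sub>2 * (1 - r)) * (h\<^sub>2 * (1 - d))"
    using cev by simp
  also have "\<dots> \<longleftrightarrow> (f\<^sub>3 * g\<^sub>3 * h\<^sub>3) * (r * d * (1 - e)) = (f\<^sub>2 * g\<^sub>2 * h\<^sub>2) * (e * (1 - r) * (1 - d))"
    by (simp add: mult_ac)
  also have "\<dots> \<longleftrightarrow> (- (f\<^sub>3 * g\<^sub>3 * h\<^sub>3)) * (e * (1 - r) * (1 - d)) = (f\<^sub>2 * g\<^sub>2 * h\<^sub>2) * (e * (1 - r) * (1 - d))"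
    unfolding men by simp
  also have "\<dots> \<longleftrightarrow> - (f\<^sub>3 * g\<^sub>3 * h\<^sub>3) = f\<^sub>2 * g\<^sub>2 * h\<^sub>2"
    using ne by (subst mult_right_cancel) auto
  also have "\<dots> \<longleftrightarrow> f\<^sub>3 * g\<^sub>3 * h\<^sub>3 = - (f\<^sub>2 * g\<^sub>2 * h\<^sub>2)"
    by linarith
  finally show ?thesis unfolding coord_defs .
qed

theorem corollary6p5:
  fixes f :: "real \<Rightarrow> real \<Rightarrow> real \<Rightarrow> real"
    and A B C D E F :: "real^2"
    and l :: "(real^2) set"
  assumes "\<not> collinear {A, B, C}"
    and "admissible_transversal A B C l"
    and "meets_sidelines_at A B C l D E F"
    and "center_function f"
    and "concurrent_for f A B C l"
    and "on_no_sideline (X_point f A E F) A E F"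
    and "on_no_sideline (X_point f B F D) B F D"
    and "on_no_sideline (X_point f C D E) C D E"
  shows "concurrent_for (isogonal_conjugate f) A B C l \<and>
         concurrent_for (isotomic_conjugate f) A B C l"
proof -
  note nz = on_no_sideline_X_point[OF assms(6)] on_no_sideline_X_point[OF assms(7)]
    on_no_sideline_X_point[OF assms(8)]
  have "A \<noteq> E \<and> A \<noteq> F \<and> B \<noteq> F \<and> B \<noteq> D \<and> C \<noteq> D \<and> C \<noteq> E"
    using assms(2,3) unfolding admissible_transversal_def meets_sidelines_at_def by blast
  then have pos: "dist A E \<noteq> 0" "dist F A \<noteq> 0" "dist B F \<noteq> 0" "dist D B \<noteq> 0" "dist C D \<noteq> 0"
    "dist E C \<noteq> 0" by auto
  define f\<^sub>2 f\<^sub>3 g\<^sub>2 g\<^sub>3 h\<^sub>2 h\<^sub>3 where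
    "f\<^sub>2 = f (dist F A) (dist A E) (dist E F)" and "f\<^sub>3 = f (dist A E) (dist E F) (dist F A)" and
    "g\<^sub>2 = f (dist D B) (dist B F) (dist F D)" and "g\<^sub>3 = f (dist B F) (dist F D) (dist D B)" and
    "h\<^sub>2 = f (dist E C) (dist C D) (dist D E)" and "h\<^sub>3 = f (dist C D) (dist D E) (dist E C)"
  note coord_defs = this
  have prod: "f\<^sub>3 * g\<^sub>3 * h\<^sub>3 = - (f\<^sub>2 * g\<^sub>2 * h\<^sub>2)"
    using concurrent_for_iff[OF assms(1-3) nz] assms(5) by (simp add: coord_defs)
  obtain d e r where "D = (1 - d) *\<^sub>R B + d *\<^sub>R C" "E = (1 - e) *\<^sub>R A + e *\<^sub>R C"
    "F = (1 - r) *\<^sub>R A + r *\<^sub>R B" "r * d * (1 - e) = - (e * (1 - r) * (1 - d))"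
    using assms(2,3) menelaus[of l A B C D E F] unfolding admissible_transversal_def by metis
  then have "dist A E * dist B F * dist C D = dist F A * dist D B * dist E C"
    by (rule menelaus_dist)
  then have sq: "(dist A E)\<^sup>2 * (dist B F)\<^sup>2 * (dist C D)\<^sup>2 = (dist F A)\<^sup>2 * (dist D B)\<^sup>2 * (dist E C)\<^sup>2"
    by (metis power_mult_distrib)
  have "concurrent_for (isotomic_conjugate f) A B C l \<longleftrightarrow>
      1 / f\<^sub>3 * (1 / g\<^sub>3) * (1 / h\<^sub>3) = - (1 / f\<^sub>2 * (1 / g\<^sub>2) * (1 / h\<^sub>2))"
    using concurrent_for_iff[OF assms(1-3), of "isotomic_conjugate f"] nz
    by (simp add: isotomic_conjugate_def coord_defs)
  also have "\<dots> \<longleftrightarrow> 1 / (f\<^sub>3 * g\<^sub>3 * h\<^sub>3) = - (1 / (f\<^sub>2 * g\<^sub>2 * h\<^sub>2))" by simp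
  finally have isotomic: "concurrent_for (isotomic_conjugate f) A B C l" using prod by simp
  have "concurrent_for (isogonal_conjugate f) A B C l \<longleftrightarrow>
      (dist A E)\<^sup>2 / f\<^sub>3 * ((dist B F)\<^sup>2 / g\<^sub>3) * ((dist C D)\<^sup>2 / h\<^sub>3) =
      - ((dist F A)\<^sup>2 / f\<^sub>2 * ((dist D B)\<^sup>2 / g\<^sub>2) * ((dist E C)\<^sup>2 / h\<^sub>2))"
    unfolding coord_defs
    using concurrent_for_iff[OF assms(1-3), of "isogonal_conjugate f"] nz pos
    by (simp add: isogonal_conjugate_def)
  also have "\<dots> \<longleftrightarrow> ((dist A E)\<^sup>2 * (dist B F)\<^sup>2 * (dist C D)\<^sup>2) / (f\<^sub>3 * g\<^sub>3 * h\<^sub>3) =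
      - (((dist F A)\<^sup>2 * (dist D B)\<^sup>2 * (dist E C)\<^sup>2) / (f\<^sub>2 * g\<^sub>2 * h\<^sub>2))" by simp
  finally have "concurrent_for (isogonal_conjugate f) A B C l" using prod sq by simp
  then show ?thesis using isotomic ..
qed

end
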